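(* Let $K$ be a quasi-algebraically closed field. Let $e \geq 3$ be an integer and let $V$ be a finite-dimensional vector space over $K$ with $\dim V \geq e+1$. Then every alternating $e$-form $\omega$ on $V$ has an $\omega$-singular $(e-1)$-dimensional subspace, i.e. there is an $(e-1)$-dimensional subspace $U \subseteq V$ with $\omega(u_1,\ldots,u_{e-1},v)=0$ for all $u_1,\ldots,u_{e-1}\in U$ and all $v \in V$.
   Context: A field $K$ is quasi-algebraically closed if every non-constant homogeneous polynomial over $K$ whose degree is strictly less than its number of variables has a non-zero root in $K^{\text{(number of variables)}}$ (e.g. every finite field, by Chevalley–Warning). An alternating $e$-form on $V$ is an alternating multilinear map $V^e \to K$. For $d \leq e$, a $d$-dimensional subspace $U$ of $V$ is called $\omega$-singular if $\omega(u_1,\ldots,u_d,v_{d+1},\ldots,v_e)=0$ for all $u_1,\ldots,u_d \in U$ and all $v_{d+1},\ldots,v_e \in V$. *)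

theory Defs
  imports Complex_Main
begin

definition monomials :: "nat \<Rightarrow> nat \<Rightarrow> (nat \<Rightarrow> nat) set" where
  "monomials n d = {\<alpha>. (\<forall>i\<ge>n. \<alpha> i = 0) \<and> (\<Sum>i<n. \<alpha> i) = d}"

definition hom_poly_eval :: "nat \<Rightarrow> nat \<Rightarrow> ((nat \<Rightarrow> nat) \<Rightarrow> 'a::field) \<Rightarrow> (nat \<Rightarrow> 'a) \<Rightarrow> 'a" where
  "hom_poly_eval n d c x = (\<Sum>\<alpha>\<in>monomials n d. c \<alpha> * (\<Prod>i<n. x i ^ \<alpha> i))"

definition quasi_alg_closed :: "'a::field itself \<Rightarrow> bool" where
  "quasi_alg_closed _ \<longleftrightarrow>
     (\<forall>n d (c :: (nat \<Rightarrow> nat) \<Rightarrow> 'a). 0 < d \<and> d < n \<and> (\<exists>\<alpha>\<in>monomials n d. c \<alpha> \<noteq> 0) \<longrightarrow>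
        (\<exists>x. (\<exists>i<n. x i \<noteq> 0) \<and> hom_poly_eval n d c x = 0))"

text \<open>An alternating e-form: omega is applied to lists of length e (values on other
  lengths are irrelevant); multilinear in each slot and vanishing when two arguments coincide.\<close>
definition alternating_form ::
  "('a::field \<Rightarrow> 'b::ab_group_add \<Rightarrow> 'b) \<Rightarrow> nat \<Rightarrow> ('b list \<Rightarrow> 'a) \<Rightarrow> bool" where
  "alternating_form scale e \<omega> \<longleftrightarrow>
     (\<forall>xs ys. length xs + length ys + 1 = e \<longrightarrow>
        (\<forall>u v. \<omega> (xs @ (u + v) # ys) = \<omega> (xs @ u # ys) + \<omega> (xs @ v # ys)) \<and>
        (\<forall>a u. \<omega> (xs @ scale a u # ys) = a * \<omega> (xs @ u # ys))) \<and>
     (\<forall>vs. length vs = e \<longrightarrow> \<not> distinct vs \<longrightarrow> \<omega> vs = 0)"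

text \<open>U is a d-dimensional omega-singular subspace (d <= e).\<close>
definition singular_subspace ::
  "('a::field \<Rightarrow> 'b::ab_group_add \<Rightarrow> 'b) \<Rightarrow> nat \<Rightarrow> ('b list \<Rightarrow> 'a) \<Rightarrow> nat \<Rightarrow> 'b set \<Rightarrow> bool" where
  "singular_subspace scale e \<omega> d U \<longleftrightarrow>
     module.subspace scale U \<and> vector_space.dim scale U = d \<and>
     (\<forall>us vs. set us \<subseteq> U \<and> length us = d \<and> length vs = e - d \<longrightarrow> \<omega> (us @ vs) = 0)"

end

(* Fixing e - 3 vectors of a basis leaves an alternating trilinear form tau on a space of dimension
   n >= 4, and it suffices to find u and v, linearly independent, with tau(u, v, .) = 0; that is, a
   nonzero u for which tau(u, ., .) is degenerate modulo u.  Write u = x + t e_n with x in the span W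
   of the other basis vectors.  The Gram determinant of tau(u, ., .) on W is a form of degree n - 1
   in u.  It is divisible by t^2, because x lies in the radical of tau(x, ., .), and the quotient h
   has degree n - 3, strictly between 0 and n, hence a nontrivial zero u.  If t is nonzero at u,
   the Gram determinant itself vanishes.  If t = 0, then h(u) is, up to a nonzero square, the Gram
   determinant of tau(u, ., .) on another complement of u. *)
theory Submission
  imports Defs "Jordan_Normal_Form.Determinant"
begin

section \<open>Homogeneous polynomial functions\<close>

text \<open>Only the existence of coefficients is recorded: over a finite field a function need not
  determine its coefficients or its degree, and the zero function is a form of every degree.\<close>

definition hom_fun :: "nat \<Rightarrow> nat \<Rightarrow> ((nat \<Rightarrow> 'a::field) \<Rightarrow> 'a) \<Rightarrow> bool" where
  "hom_fun n d f \<longleftrightarrow> (\<exists>c. f = hom_poly_eval n d c)"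

lemma finite_monomials: "finite (monomials n d)"
proof (rule finite_subset)
  show "monomials n d \<subseteq> {\<alpha>. \<forall>i. (i \<in> {..<n} \<longrightarrow> \<alpha> i \<in> {..d}) \<and> (i \<notin> {..<n} \<longrightarrow> \<alpha> i = 0)}"
    by (auto simp: monomials_def intro: member_le_sum)
  show "finite \<dots>"
    by (rule finite_set_of_finite_funs) auto
qed

lemma hom_fun_zero: "hom_fun n d (\<lambda>x. 0)"
  unfolding hom_fun_def by (rule exI[of _ "\<lambda>_. 0"]) (simp add: hom_poly_eval_def fun_eq_iff)

lemma hom_fun_add:
  assumes "hom_fun n d f" "hom_fun n d g"
  shows "hom_fun n d (\<lambda>x. f x + g x)"
proof -
  from assms obtain c c' where "f = hom_poly_eval n d c" "g = hom_poly_eval n d c'"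
    by (auto simp: hom_fun_def)
  then have "(\<lambda>x. f x + g x) = hom_poly_eval n d (\<lambda>\<alpha>. c \<alpha> + c' \<alpha>)"
    by (simp add: hom_poly_eval_def fun_eq_iff distrib_right sum.distrib)
  then show ?thesis by (auto simp: hom_fun_def)
qed

lemma hom_fun_cmult:
  assumes "hom_fun n d f"
  shows "hom_fun n d (\<lambda>x. a * f x)"
proof -
  from assms obtain c where "f = hom_poly_eval n d c"
    by (auto simp: hom_fun_def)
  then have "(\<lambda>x. a * f x) = hom_poly_eval n d (\<lambda>\<alpha>. a * c \<alpha>)"
    by (simp add: hom_poly_eval_def fun_eq_iff sum_distrib_left mult.assoc)
  then show ?thesis by (auto simp: hom_fun_def)
qed

lemma hom_fun_sum:
  assumes "\<And>i. i \<in> I \<Longrightarrow> hom_fun n d (f i)"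
  shows "hom_fun n d (\<lambda>x. \<Sum>i\<in>I. f i x)"
  using assms
  by (induction I rule: infinite_finite_induct) (auto intro: hom_fun_zero hom_fun_add)

lemma hom_fun_const: "hom_fun n 0 (\<lambda>x. a)"
proof -
  have "monomials n 0 = {\<lambda>_. 0}"
    by (auto simp: monomials_def fun_eq_iff) (metis leI lessThan_iff)
  then have "(\<lambda>x. a) = hom_poly_eval n 0 (\<lambda>_. a)"
    by (simp add: hom_poly_eval_def fun_eq_iff)
  then show ?thesis by (auto simp: hom_fun_def)
qed

text \<open>Multiplication by \<open>x i\<close> merely shifts exponents. Products of forms are then
  built up variable by variable, without convolving coefficient families.\<close>

lemma hom_fun_var_mult:
  assumes "hom_fun n d f" and i: "i < n"
  shows "hom_fun n (Suc d) (\<lambda>x. x i * f x)"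
proof -
  from assms obtain c where f: "f = hom_poly_eval n d c"
    by (auto simp: hom_fun_def)
  \<comment> \<open>The case \<open>\<beta> i = 0\<close> is set apart because truncated subtraction
    would otherwise give a coefficient to monomials not divisible by \<open>x i\<close>.\<close>
  define c' where "c' = (\<lambda>\<beta>::nat\<Rightarrow>nat. if \<beta> i = 0 then 0 else c (\<beta>(i := \<beta> i - 1)))"
  let ?up = "\<lambda>\<alpha>::nat\<Rightarrow>nat. \<alpha>(i := Suc (\<alpha> i))"
  let ?dn = "\<lambda>\<beta>::nat\<Rightarrow>nat. \<beta>(i := \<beta> i - 1)"
  have split: "(\<Sum>j<n. \<alpha> j) = \<alpha> i + (\<Sum>j\<in>{..<n}-{i}. \<alpha> j)" for \<alpha> :: "nat \<Rightarrow> nat"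
    using i by (simp add: sum.remove)
  have up: "?up \<alpha> \<in> monomials n (Suc d)" if "\<alpha> \<in> monomials n d" for \<alpha>
    using that i split[of \<alpha>] split[of "?up \<alpha>"] by (auto simp: monomials_def)
  have dn: "?dn \<beta> \<in> monomials n d" if "\<beta> \<in> monomials n (Suc d)" "\<beta> i \<noteq> 0" for \<beta>
    using that i split[of \<beta>] split[of "?dn \<beta>"] by (auto simp: monomials_def)
  have pr: "(\<Prod>j<n. x j ^ ?up \<alpha> j) = x i * (\<Prod>j<n. x j ^ \<alpha> j)" for \<alpha> and x :: "nat \<Rightarrow> 'a"
    using i by (simp add: prod.remove[of _ i])
  have "x i * f x = hom_poly_eval n (Suc d) c' x" for x
  proof -
    have "hom_poly_eval n (Suc d) c' x
        = (\<Sum>\<beta>\<in>{\<beta>\<in>monomials n (Suc d). \<beta> i \<noteq> 0}. c' \<beta> * (\<Prod>j<n. x j ^ \<beta> j))"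
      unfolding hom_poly_eval_def
      by (rule sum.mono_neutral_right) (auto simp: finite_monomials c'_def)
    also have "\<dots> = (\<Sum>\<alpha>\<in>monomials n d. c \<alpha> * (x i * (\<Prod>j<n. x j ^ \<alpha> j)))"
      by (rule sum.reindex_bij_witness[of _ ?up ?dn])
        (auto simp: c'_def pr[symmetric] up dn[simplified] simp del: fun_upd_apply, auto)
    also have "\<dots> = x i * f x"
      by (simp add: f hom_poly_eval_def sum_distrib_left algebra_simps)
    finally show ?thesis by simp
  qed
  then have "(\<lambda>x. x i * f x) = hom_poly_eval n (Suc d) c'"
    by (simp add: fun_eq_iff)
  then show ?thesis by (auto simp: hom_fun_def)
qed

lemma hom_fun_power_mult:
  assumes "hom_fun n d f" and "i < n"
  shows "hom_fun n (k + d) (\<lambda>x. x i ^ k * f x)"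
  by (induction k) (use assms hom_fun_var_mult in \<open>auto simp: mult.assoc\<close>)

lemma hom_fun_monomial_mult:
  assumes "hom_fun n d f" and "k \<le> n"
  shows "hom_fun n ((\<Sum>i<k. \<alpha> i) + d) (\<lambda>x. (\<Prod>i<k. x i ^ \<alpha> i) * f x)"
  using assms(2)
proof (induction k)
  case (Suc k)
  then have "hom_fun n (\<alpha> k + ((\<Sum>i<k. \<alpha> i) + d)) (\<lambda>x. x k ^ \<alpha> k * ((\<Prod>i<k. x i ^ \<alpha> i) * f x))"
    by (intro hom_fun_power_mult) auto
  then show ?case by (simp add: algebra_simps)
qed (use assms in auto)

lemma hom_fun_mult:
  assumes f: "hom_fun n d f" and g: "hom_fun n e g"
  shows "hom_fun n (d + e) (\<lambda>x. f x * g x)"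
proof -
  from f obtain c where "f = hom_poly_eval n d c"
    by (auto simp: hom_fun_def)
  then have "(\<lambda>x. f x * g x) = (\<lambda>x. \<Sum>\<alpha>\<in>monomials n d. c \<alpha> * ((\<Prod>i<n. x i ^ \<alpha> i) * g x))"
    by (simp add: hom_poly_eval_def fun_eq_iff sum_distrib_right mult.assoc)
  moreover have "hom_fun n (d + e) (\<lambda>x. c \<alpha> * ((\<Prod>i<n. x i ^ \<alpha> i) * g x))"
    if "\<alpha> \<in> monomials n d" for \<alpha>
    using hom_fun_cmult[OF hom_fun_monomial_mult[OF g order_refl, of \<alpha>]] that
    by (simp add: monomials_def)
  ultimately show ?thesis by (simp only: hom_fun_sum[where f = "\<lambda>\<alpha> x. c \<alpha> * ((\<Prod>i<n. x i ^ \<alpha> i) * g x)"])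
qed

lemma quasi_alg_closed_hom_fun_root:
  assumes "quasi_alg_closed TYPE('a::field)" "hom_fun n d (f :: (nat \<Rightarrow> 'a) \<Rightarrow> 'a)" "0 < d" "d < n"
  shows "\<exists>x. (\<exists>i<n. x i \<noteq> 0) \<and> f x = 0"
proof -
  from assms obtain c where f: "f = hom_poly_eval n d c"
    by (auto simp: hom_fun_def)
  show ?thesis
  proof (cases "\<exists>\<alpha>\<in>monomials n d. c \<alpha> \<noteq> 0")
    case True
    then show ?thesis
      using assms(1,3,4) unfolding f quasi_alg_closed_def by metis
  next
    case False
    \<comment> \<open>With all coefficients zero, \<open>quasi_alg_closed\<close> says nothing; but
      then \<open>f\<close> vanishes everywhere, in particular at the all-one vector.\<close>
    then have "f (\<lambda>_. 1) = 0"
      by (auto simp: f hom_poly_eval_def)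
    then show ?thesis
      using assms(4) by (intro exI[of _ "\<lambda>_. 1"]) auto
  qed
qed

section \<open>Polynomials in one indeterminate with forms as coefficients\<close>

text \<open>Joint homogeneity of degree \<open>m\<close> in \<open>x\<close> and the indeterminate
  t. Keeping the last coordinate formal lets a factor t^2 be read off from coefficients, which
  functions on a finite field would not allow.\<close>

definition graded_poly :: "nat \<Rightarrow> nat \<Rightarrow> ((nat \<Rightarrow> 'a::field) \<Rightarrow> 'a poly) \<Rightarrow> bool" where
  "graded_poly n m P \<longleftrightarrow>
     (\<forall>k\<le>m. hom_fun n (m - k) (\<lambda>x. coeff (P x) k)) \<and> (\<forall>x. degree (P x) \<le> m)"

lemma graded_poly_zero: "graded_poly n m (\<lambda>x. 0)"
  by (simp add: graded_poly_def hom_fun_zero)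

lemma graded_poly_const: "graded_poly n 0 (\<lambda>x. [:a:])"
  by (simp add: graded_poly_def hom_fun_const)

lemma graded_poly_add:
  assumes "graded_poly n m P" "graded_poly n m Q"
  shows "graded_poly n m (\<lambda>x. P x + Q x)"
  using assms by (simp add: graded_poly_def hom_fun_add degree_add_le)

lemma graded_poly_sum:
  assumes "\<And>i. i \<in> I \<Longrightarrow> graded_poly n m (P i)"
  shows "graded_poly n m (\<lambda>x. \<Sum>i\<in>I. P i x)"
  using assms
  by (induction I rule: infinite_finite_induct) (auto intro: graded_poly_zero graded_poly_add)

lemma graded_poly_mult:
  assumes P: "graded_poly n l P" and Q: "graded_poly n m Q"
  shows "graded_poly n (l + m) (\<lambda>x. P x * Q x)"
  unfolding graded_poly_def
proof (intro conjI allI impI)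
  fix k assume k: "k \<le> l + m"
  have "hom_fun n (l + m - k) (\<lambda>x. coeff (P x) i * coeff (Q x) (k - i))" if i: "i \<le> k" for i
  proof (cases "i \<le> l \<and> k - i \<le> m")
    case True
    then have "hom_fun n ((l - i) + (m - (k - i))) (\<lambda>x. coeff (P x) i * coeff (Q x) (k - i))"
      using P Q by (intro hom_fun_mult) (auto simp: graded_poly_def)
    moreover have "(l - i) + (m - (k - i)) = l + m - k"
      using True i by linarith
    ultimately show ?thesis by simp
  next
    case False
    \<comment> \<open>Out of range, the truncated degrees need not add up to
      \<open>l + m - k\<close>, but the degree bounds make one factor vanish.\<close>
    then have "(\<lambda>x. coeff (P x) i * coeff (Q x) (k - i)) = (\<lambda>x. 0)"
      using P Q by (auto simp: graded_poly_def fun_eq_iff) (meson coeff_eq_0 le_less_trans not_less)+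
    then show ?thesis by (simp add: hom_fun_zero)
  qed
  then show "hom_fun n (l + m - k) (\<lambda>x. coeff (P x * Q x) k)"
    unfolding coeff_mult
    by (intro hom_fun_sum[where f = "\<lambda>i x. coeff (P x) i * coeff (Q x) (k - i)"]) auto
next
  show "degree (P x * Q x) \<le> l + m" for x
    using P Q degree_mult_le[of "P x" "Q x"] by (auto simp: graded_poly_def) (meson add_mono order_trans)
qed

lemma graded_poly_prod:
  assumes "finite I" "\<And>i. i \<in> I \<Longrightarrow> graded_poly n 1 (P i)"
  shows "graded_poly n (card I) (\<lambda>x. \<Prod>i\<in>I. P i x)"
  using assms
proof (induction I)
  case empty
  then show ?case using graded_poly_const[of n 1] by (simp add: one_pCons)
next
  case (insert i I)
  then show ?case
    using graded_poly_mult[of n 1 "P i" "card I" "\<lambda>x. \<Prod>i\<in>I. P i x"] by simp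
qed

text \<open>Each term of the Leibniz formula is a product of \<open>m\<close> entries of degree 1,
  with a sign of degree 0.\<close>

lemma graded_poly_det:
  assumes "\<And>i j. i < m \<Longrightarrow> j < m \<Longrightarrow> graded_poly n 1 (\<lambda>x. P x i j)"
  shows "graded_poly n m (\<lambda>x. det (mat m m (\<lambda>(i, j). P x i j)))"
proof -
  have 1: "graded_poly n m (\<lambda>x. signof p * (\<Prod>i = 0..<m. P x i (p i)))"
    if p: "p permutes {0..<m}" for p
  proof -
    have "graded_poly n 0 (\<lambda>x. signof p :: 'a poly)"
      using graded_poly_const[of n "1::'a"] graded_poly_const[of n "-1::'a"]
      by (cases p rule: sign_cases) (simp_all add: one_pCons)
    moreover have "graded_poly n (card {0..<m}) (\<lambda>x. \<Prod>i = 0..<m. P x i (p i))"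
      using permutes_in_image[OF p] by (intro graded_poly_prod assms) auto
    ultimately show ?thesis
      using graded_poly_mult by fastforce
  qed
  have "det (mat m m (\<lambda>(i, j). P x i j))
      = (\<Sum>p | p permutes {0..<m}. signof p * (\<Prod>i = 0..<m. P x i (p i)))" for x
    using permutes_in_image by (subst det_def'[of _ m]) (auto intro!: sum.cong prod.cong)
  then show ?thesis
    using 1 by (simp only:)
      (rule graded_poly_sum[where P = "\<lambda>p x. signof p * (\<Prod>i = 0..<m. P x i (p i))"], simp)
qed

section \<open>Alternating trilinear tensors\<close>

text \<open>The row and column added in the induction step cancel by skewness. The zero diagonal is
  a separate hypothesis, since skewness does not imply it in characteristic 2.\<close>

lemma alternating_quadratic_form_zero:
  fixes A :: "nat \<Rightarrow> nat \<Rightarrow> 'a::comm_ring_1"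
  assumes "\<And>i j. A i j = - A j i" and "\<And>i. A i i = 0"
  shows "(\<Sum>i<n. \<Sum>j<n. u i * u j * A i j) = 0"
proof (induction n)
  case (Suc n)
  have "(\<Sum>j<n. u n * u j * A n j) = - (\<Sum>i<n. u i * u n * A i n)"
    by (subst assms(1)) (simp add: sum_negf[symmetric] mult_ac)
  then show ?case
    using Suc by (simp add: sum.distrib assms(2))
qed simp

text \<open>Replacing row and column \<open>p\<close> of \<open>B + tC\<close> by the combinations with coefficients \<open>x\<close> makes
  both of them divisible by \<open>t\<close>, and their common entry zero.\<close>
lemma det_pencil_kernel:
  fixes B C :: "nat \<Rightarrow> nat \<Rightarrow> 'a::field" and x :: "nat \<Rightarrow> 'a" and m p :: nat
  defines "D \<equiv> det (mat m m (\<lambda>(i, j). [:B i j, C i j:]))"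
  defines "F \<equiv> mat m m (\<lambda>(i, j). if i = p then if j = p then 0 else \<Sum>k<m. C j k * x k
                 else if j = p then \<Sum>k<m. x k * C k i else B j i)"
  assumes p: "p < m" "x p \<noteq> 0"
    and right: "\<And>i. i < m \<Longrightarrow> (\<Sum>j<m. B i j * x j) = 0"
    and left: "\<And>j. j < m \<Longrightarrow> (\<Sum>i<m. x i * B i j) = 0"
    and quad: "(\<Sum>i<m. \<Sum>j<m. x i * C i j * x j) = 0"
  shows "coeff D 0 = 0" "coeff D 1 = 0" "x p ^ 2 * coeff D 2 = det F"
proof -
  define t :: "'a poly" where "t = [:0, 1:]"
  define M where "M = mat m m (\<lambda>(i, j). [:B i j, C i j:])"
  define v where "v = vec m (\<lambda>i. [:x i:])"
  define c where "c = (\<lambda>i. \<Sum>k<m. C i k * x k)"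
  define r where "r = (\<lambda>i. \<Sum>k<m. x k * C k i)"
  \<comment> \<open>By Cramer's rule each replacement of column \<open>p\<close> multiplies the
    determinant by \<open>x p\<close>. The transposition makes the second one act on a row of
    \<open>M\<close>, whence the swapped indices in \<open>G\<close> and \<open>F\<close>.\<close>
  define A where "A = transpose_mat (replace_col M (M *\<^sub>v v) p)"
  define R where "R = replace_col A (A *\<^sub>v v) p"
  define G where "G = mat m m (\<lambda>(i, j). if i = p then if j = p then 0 else [:c j:]
                 else if j = p then [:r i:] else [:B j i, C j i:])"
  have M: "M \<in> carrier_mat m m" and v: "v \<in> carrier_vec m" and G: "G \<in> carrier_mat m m"
    by (auto simp: M_def v_def G_def)
  then have A: "A \<in> carrier_mat m m"
    by (auto simp: A_def replace_col_def)
  have detA: "det A = [:x p:] * D"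
  proof -
    have "det A = det (replace_col M (M *\<^sub>v v) p)"
      unfolding A_def by (rule det_transpose[of _ m]) (use M in \<open>auto simp: replace_col_def\<close>)
    also have "\<dots> = [:x p:] * D"
      using cramer_lemma_mat[OF M v p(1)] p by (simp add: v_def D_def M_def)
    finally show ?thesis .
  qed
  have detR: "det R = [:x p:] * ([:x p:] * D)"
    unfolding R_def using cramer_lemma_mat[OF A v p(1)] p detA by (simp add: v_def)
  have sum_pCons: "(\<Sum>i\<in>I. [:f i, g i:]) = [:\<Sum>i\<in>I. f i, \<Sum>i\<in>I. g i:]"
    for I :: "nat set" and f g :: "nat \<Rightarrow> 'a"
    by (induction I rule: infinite_finite_induct) auto
  have Mv: "(M *\<^sub>v v) $ i = [:0, c i:]" if "i < m" for i
  proof -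
    have "(M *\<^sub>v v) $ i = (\<Sum>j<m. [:B i j * x j, C i j * x j:])"
      using that by (auto simp: M_def v_def scalar_prod_def lessThan_atLeast0 mult.commute intro!: sum.cong)
    then show ?thesis
      using right[OF that] by (simp add: sum_pCons c_def)
  qed
  have A_index: "A $$ (i, j) = (if i = p then [:0, c j:] else [:B j i, C j i:])"
    if "i < m" "j < m" for i j
    using that M Mv by (simp add: A_def replace_col_def) (simp add: M_def)
  \<comment> \<open>For \<open>i = p\<close> this is the common entry of the new row and column, the
    value at \<open>x\<close> of the quadratic form of B + tC.\<close>
  have Av: "(A *\<^sub>v v) $ i = (if i = p then 0 else [:0, r i:])" if i: "i < m" for i
  proof (cases "i = p")
    case True
    have "(A *\<^sub>v v) $ i = (\<Sum>j<m. [:0, x j * c j:])"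
      using i A True by (auto simp: v_def scalar_prod_def lessThan_atLeast0 A_index intro!: sum.cong)
    moreover have "(\<Sum>j<m. x j * c j) = 0"
      using quad by (simp add: c_def sum_distrib_left mult.assoc)
    ultimately show ?thesis using True by (simp add: sum_pCons)
  next
    case False
    have "(A *\<^sub>v v) $ i = (\<Sum>j<m. [:x j * B j i, x j * C j i:])"
      using i A False by (auto simp: v_def scalar_prod_def lessThan_atLeast0 A_index intro!: sum.cong)
    then show ?thesis using False left[OF i] by (simp add: sum_pCons r_def)
  qed
  \<comment> \<open>\<open>G\<close> is \<open>R\<close> with one factor t taken out of row
    \<open>p\<close> and one out of column \<open>p\<close>; the corner is zero anyway.\<close>
  have "R = transpose_mat (multrow p t (transpose_mat (multrow p t G)))"
  proof (rule eq_matI)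
    fix i j assume "i < dim_row (transpose_mat (multrow p t (transpose_mat (multrow p t G))))"
      "j < dim_col (transpose_mat (multrow p t (transpose_mat (multrow p t G))))"
    then have ij: "i < m" "j < m" using G by auto
    then have "R $$ (i, j) = (if j = p then if i = p then 0 else [:0, r i:] else A $$ (i, j))"
      using A Av by (simp add: R_def replace_col_def)
    then show "R $$ (i, j) = transpose_mat (multrow p t (transpose_mat (multrow p t G))) $$ (i, j)"
      using ij G by (simp add: A_index) (simp add: G_def t_def)
  qed (use A G in \<open>auto simp: R_def replace_col_def\<close>)
  moreover have "det (transpose_mat (multrow p t (transpose_mat (multrow p t G)))) = t * (t * det G)"
    using G by (subst det_transpose[of _ m], simp, subst det_multrow[OF p(1)], simp,
        subst det_transpose[of _ m], simp, subst det_multrow[OF p(1)], simp_all)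
  ultimately have eq: "smult (x p ^ 2) D = t ^ 2 * det G"
    using detR by (simp add: power2_eq_square mult.assoc)
  have coeffs: "x p ^ 2 * coeff D k = coeff (t ^ 2 * det G) k" for k
    by (simp flip: eq)
  show "coeff D 0 = 0" "coeff D 1 = 0"
    using coeffs[of 0] coeffs[of 1] p by (simp_all add: t_def power2_eq_square coeff_pCons)
  \<comment> \<open>Evaluation at t = 0 turns \<open>G\<close> into \<open>F\<close>, and
    \<open>det G\<close> into the coefficient of t^2 in \<open>t ^ 2 * det G\<close>.\<close>
  interpret h: comm_ring_hom "\<lambda>q :: 'a poly. poly q 0"
    by unfold_locales auto
  have "map_mat (\<lambda>q. poly q 0) G = F"
    by (rule eq_matI) (auto simp: G_def F_def c_def r_def)
  then have "det F = poly (det G) 0"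
    using h.hom_det[of G] by simp
  also have "\<dots> = coeff (t ^ 2 * det G) 2"
    by (simp add: t_def power2_eq_square coeff_pCons poly_0_coeff_0 numeral_2_eq_2)
  finally show "x p ^ 2 * coeff D 2 = det F"
    using coeffs[of 2] by simp
qed

lemma hom_fun_linear: "k \<le> n \<Longrightarrow> hom_fun n 1 (\<lambda>x. \<Sum>i<k. x i * a i)"
  by (intro hom_fun_sum[where f = "\<lambda>i x. x i * a i"])
    (simp add: hom_fun_var_mult[OF hom_fun_const, simplified])

lemma singular_mat_kernel:
  fixes f :: "nat \<Rightarrow> nat \<Rightarrow> 'a::field"
  assumes "det (mat m m (\<lambda>(i, j). f i j)) = 0"
  obtains y i where "i < m" "y i \<noteq> 0" "\<And>i. i < m \<Longrightarrow> (\<Sum>j<m. f i j * y j) = 0"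
proof -
  let ?A = "mat m m (\<lambda>(i, j). f i j)"
  obtain v where v: "v \<in> carrier_vec m" "v \<noteq> 0\<^sub>v m" "?A *\<^sub>v v = 0\<^sub>v m"
    using det_0_iff_vec_prod_zero_field[of ?A m] assms by auto
  then obtain i where "i < m" "v $ i \<noteq> 0"
    by (metis carrier_vecD eq_vecI index_zero_vec(1) index_zero_vec(2))
  moreover have "(\<Sum>j<m. f i j * v $ j) = 0" if "i < m" for i
  proof -
    have "(?A *\<^sub>v v) $ i = (\<Sum>j<m. f i j * v $ j)"
      using that v(1) by (auto simp: scalar_prod_def lessThan_atLeast0 intro!: sum.cong)
    then show ?thesis using v(3) that by simp
  qed
  ultimately show ?thesis by (rule that)
qed

text \<open>The trilinear case in coordinates. The positions \<open>p\<close> and \<open>q\<close>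
  witness that \<open>u\<close> and \<open>v\<close> are linearly independent.\<close>

theorem alternating_tensor_singular_pair:
  fixes T :: "nat \<Rightarrow> nat \<Rightarrow> nat \<Rightarrow> 'a::field"
  assumes qac: "quasi_alg_closed TYPE('a)" and n: "n \<ge> 4"
    and skew12: "\<And>i j k. T i j k = - T j i k" and diag12: "\<And>i k. T i i k = 0"
    and skew23: "\<And>i j k. T i j k = - T i k j" and diag23: "\<And>i k. T i k k = 0"
  obtains u v p q where "p < n" "u p \<noteq> 0" "v p = 0" "q < n" "v q \<noteq> 0"
    "\<And>k. k < n \<Longrightarrow> (\<Sum>i<n. \<Sum>j<n. u i * v j * T i j k) = 0"
proof -
  note conclude = that
  have skew13: "T i j k = - T k j i" for i j k
    by (metis skew12 skew23)
  have diag13: "T i j i = 0" for i j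
    by (metis skew12 diag23 neg_equal_zero neg_0_equal_iff_equal)
  obtain m where m: "n = Suc m" "m \<ge> 3"
    using n by (cases n) auto
  \<comment> \<open>The index \<open>m\<close> is the last basis vector, and \<open>B u\<close> is
    the Gram matrix on W of tau(x, ., .), where x is the part of \<open>u\<close> in W. In
    \<open>D\<close> the coordinate t along that vector is an indeterminate.\<close>
  define B where "B = (\<lambda>u i j. \<Sum>k<m. u k * T k i j)"
  define D where "D = (\<lambda>u. det (mat m m (\<lambda>(i, j). [:B u i j, T m i j:])))"
  have D_graded: "graded_poly n m D"
  proof -
    have "hom_fun n (1 - k) (\<lambda>u. coeff [:B u i j, T m i j:] k)" if "k \<le> 1" for i j k
      using that m hom_fun_linear[of m n "\<lambda>k. T k i j"] hom_fun_const[of n "T m i j"]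
      by (cases k) (auto simp: B_def)
    then show ?thesis
      unfolding D_def by (intro graded_poly_det) (simp add: graded_poly_def)
  qed
  \<comment> \<open>This is \<open>D u\<close> divided by t^2, evaluated at t = \<open>u m\<close>.
    That the coefficients below 2 vanish is shown only later, for the root \<open>u\<close>.\<close>
  define h where "h = (\<lambda>u. \<Sum>k=2..m. u m ^ (k - 2) * coeff (D u) k)"
  have "hom_fun n (m - 2) h"
    unfolding h_def
  proof (rule hom_fun_sum[where f = "\<lambda>k u. u m ^ (k - 2) * coeff (D u) k"])
    fix k assume k: "k \<in> {2..m}"
    then have "hom_fun n ((k - 2) + (m - k)) (\<lambda>u. u m ^ (k - 2) * coeff (D u) k)"
      using D_graded m by (intro hom_fun_power_mult) (auto simp: graded_poly_def)
    then show "hom_fun n (m - 2) (\<lambda>u. u m ^ (k - 2) * coeff (D u) k)"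
      using k by simp
  qed
  then obtain u p where p: "p < n" "u p \<noteq> 0" and hu: "h u = 0"
    using quasi_alg_closed_hom_fun_root[OF qac, of n "m - 2" h] m by fastforce
  define S where "S = (\<lambda>v k. \<Sum>i<n. \<Sum>j<n. u i * v j * T i j k)"
  \<comment> \<open>It suffices to test tau(u, v, .) on the basis vectors other than
    \<open>p\<close>: tau(u, v, u) = 0 and \<open>u p\<close> is nonzero, so the value at index
    \<open>p\<close> follows.\<close>
  have finish: thesis
    if "p < n" "u p \<noteq> 0" "v p = 0" "q < n" "v q \<noteq> 0" and S: "\<And>k. k < n \<Longrightarrow> k \<noteq> p \<Longrightarrow> S v k = 0" for v p q
  proof -
    have "(\<Sum>k<n. u k * S v k) = (\<Sum>k<n. \<Sum>j<n. \<Sum>i<n. u k * u i * (v j * T i j k))"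
      unfolding S_def sum_distrib_left
      by (rule sum.cong[OF refl], subst sum.swap) (simp add: mult_ac)
    also have "\<dots> = (\<Sum>j<n. \<Sum>k<n. \<Sum>i<n. u k * u i * (v j * T i j k))"
      by (rule sum.swap)
    also have "\<dots> = (\<Sum>j<n. v j * (\<Sum>k<n. \<Sum>i<n. u k * u i * T i j k))"
      by (simp add: sum_distrib_left mult_ac)
    also have "\<dots> = 0"
    proof (intro sum.neutral ballI)
      fix j
      show "v j * (\<Sum>k<n. \<Sum>i<n. u k * u i * T i j k) = 0"
        using alternating_quadratic_form_zero[of "\<lambda>k i. T i j k", OF skew13 diag13, of u n] by simp
    qed
    finally have "u p * S v p + (\<Sum>k\<in>{..<n} - {p}. u k * S v k) = 0"
      using \<open>p < n\<close> by (simp add: sum.remove)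
    moreover have "(\<Sum>k\<in>{..<n} - {p}. u k * S v k) = 0"
      using S by (intro sum.neutral) auto
    ultimately have "S v p = 0"
      using \<open>u p \<noteq> 0\<close> by simp
    then have "S v k = 0" if "k < n" for k
      using S that by metis
    then show thesis
      using conclude that(1-5) unfolding S_def by blast
  qed
  define Q where "Q = (\<lambda>j k. \<Sum>i<n. u i * T i j k)"
  have S_Q: "S v k = (\<Sum>j<n. v j * Q j k)" for v k
    unfolding S_def Q_def by (subst sum.swap) (simp add: sum_distrib_left mult_ac)
  have Q_skew: "Q j k = - Q k j" for j k
    unfolding Q_def by (subst skew23) (simp add: sum_negf)
  have kernel: "coeff (D u) 0 = 0" "coeff (D u) 1 = 0"
    "u p ^ 2 * coeff (D u) 2 =
      det (mat m m (\<lambda>(i, j). if i = p then if j = p then 0 else \<Sum>k<m. T m j k * u k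
                 else if j = p then \<Sum>k<m. u k * T m k i else B u j i))"
    if "p < m" "u p \<noteq> 0" for p
  proof -
    \<comment> \<open>The three facts say that x lies in both kernels of \<open>B u\<close> and is
      isotropic for \<open>T m\<close>, as \<open>det_pencil_kernel\<close> requires.\<close>
    have 1: "(\<Sum>j<m. B u i j * u j) = 0" for i
      using alternating_quadratic_form_zero[of "\<lambda>j k. T k i j", OF skew13 diag13, of u m]
      by (simp add: B_def sum_distrib_left sum_distrib_right mult_ac)
    have 2: "(\<Sum>i<m. u i * B u i j) = 0" for j
      using alternating_quadratic_form_zero[of "\<lambda>i k. T k i j", OF skew12 diag12, of u m]
      by (simp add: B_def sum_distrib_left sum_distrib_right mult_ac)
    have 3: "(\<Sum>i<m. \<Sum>j<m. u i * T m i j * u j) = 0"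
      using alternating_quadratic_form_zero[of "\<lambda>i j. T m i j", OF skew23 diag23, of u m]
      by (simp add: mult_ac)
    show "coeff (D u) 0 = 0" "coeff (D u) 1 = 0"
      "u p ^ 2 * coeff (D u) 2 =
      det (mat m m (\<lambda>(i, j). if i = p then if j = p then 0 else \<Sum>k<m. T m j k * u k
                 else if j = p then \<Sum>k<m. u k * T m k i else B u j i))"
      using det_pencil_kernel[of p m u "B u" "T m", OF that 1 2 3] unfolding D_def by simp_all
  qed
  have coeff01: "coeff (D u) 0 = 0 \<and> coeff (D u) 1 = 0"
  proof (cases "\<exists>p<m. u p \<noteq> 0")
    case True
    then show ?thesis using kernel by blast
  next
    case False
    \<comment> \<open>If x = 0, then \<open>B u\<close> is zero and \<open>D u\<close> is a multiple
      of t^m, with \<open>m \<ge> 3\<close>.\<close>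
    then have "mat m m (\<lambda>(i, j). [:B u i j, T m i j:]) = [:0, 1:] \<cdot>\<^sub>m mat m m (\<lambda>(i, j). [:T m i j:])"
      by (intro eq_matI) (auto simp: B_def intro!: sum.neutral)
    then have "D u = monom 1 m * det (mat m m (\<lambda>(i, j). [:T m i j:]))"
      by (simp add: D_def monom_altdef)
    then show ?thesis
      using m by (simp add: coeff_monom_mult)
  qed
  show thesis
  proof (cases "u m = 0")
    case False
    \<comment> \<open>At t = \<open>u m\<close> the polynomial takes the value
      \<open>u m ^ 2 * h u = 0\<close>, which is also the Gram determinant of tau(u, ., .) on
      W.\<close>
    have "poly (D u) (u m) = (\<Sum>k\<le>m. coeff (D u) k * u m ^ k)"
      unfolding poly_altdef using D_graded
      by (intro sum.mono_neutral_left) (auto simp: graded_poly_def coeff_eq_0)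
    also have "{..m} = insert 0 (insert 1 {2..m})"
      using m by auto
    also have "(\<Sum>k\<in>insert 0 (insert 1 {2..m}). coeff (D u) k * u m ^ k)
        = (\<Sum>k=2..m. coeff (D u) k * u m ^ k)"
      using coeff01 by simp
    also have "\<dots> = (\<Sum>k=2..m. coeff (D u) k * (u m ^ 2 * u m ^ (k - 2)))"
      by (intro sum.cong) (auto simp only: atLeastAtMost_iff power_add[symmetric] le_add_diff_inverse)
    also have "\<dots> = u m ^ 2 * h u"
      by (simp add: h_def sum_distrib_left mult_ac)
    finally have "poly (D u) (u m) = 0"
      using hu by simp
    moreover interpret h: comm_ring_hom "\<lambda>q :: 'a poly. poly q (u m)"
      by unfold_locales auto
    have "map_mat (\<lambda>q. poly q (u m)) (mat m m (\<lambda>(i, j). [:B u i j, T m i j:]))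
        = mat m m (\<lambda>(i, j). Q i j)"
      using m by (intro eq_matI) (auto simp: B_def Q_def)
    ultimately have "det (mat m m (\<lambda>(i, j). Q i j)) = 0"
      using h.hom_det[of "mat m m (\<lambda>(i, j). [:B u i j, T m i j:])"] by (simp add: D_def)
    then obtain y q where y: "q < m" "y q \<noteq> 0" "\<And>i. i < m \<Longrightarrow> (\<Sum>j<m. Q i j * y j) = 0"
      by (rule singular_mat_kernel) blast
    show thesis
    proof (rule finish[of m "y(m := 0)" q])
      fix k assume "k < n" "k \<noteq> m"
      then have "k < m" using m by simp
      have "S (y(m := 0)) k = (\<Sum>j<m. y j * Q j k)"
        by (simp add: S_Q m)
      also have "\<dots> = - (\<Sum>j<m. Q k j * y j)"
        by (subst Q_skew) (simp add: sum_negf mult.commute)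
      finally show "S (y(m := 0)) k = 0"
        using y(3)[OF \<open>k < m\<close>] by simp
    qed (use m False y in auto)
  next
    case True
    then have pm: "p < m" using p m by (cases "p = m") auto
    have QB: "Q j k = B u j k" for j k
      using True m by (simp add: Q_def B_def)
    \<comment> \<open>Since \<open>u m = 0\<close>, only the term with exponent
      \<open>k - 2 = 0\<close> survives.\<close>
    have "h u = coeff (D u) 2"
      unfolding h_def using m True
      by (subst sum.remove[of _ 2]) (auto intro!: sum.neutral)
    then have "det (mat m m (\<lambda>(i, j). if i = p then if j = p then 0 else \<Sum>k<m. T m j k * u k
                 else if j = p then \<Sum>k<m. u k * T m k i else B u j i)) = 0"
      using kernel(3)[OF pm p(2)] hu by simp
    then obtain y q where q: "q < m" "y q \<noteq> 0"
      and "\<And>i. i < m \<Longrightarrow> (\<Sum>j<m. (if i = p then if j = p then 0 else \<Sum>k<m. T m j k * u k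
                 else if j = p then \<Sum>k<m. u k * T m k i else B u j i) * y j) = 0"
      by (rule singular_mat_kernel) blast
    moreover have "(\<Sum>k<m. T m j k * u k) = Q m j" for j
    proof -
      have "T m j k = T k m j" for k
        by (metis skew12 skew23 minus_minus)
      then show ?thesis by (simp add: QB B_def mult.commute)
    qed
    moreover have "(\<Sum>k<m. u k * T m k i) = - Q m i" for i
      unfolding QB B_def by (subst skew12) (simp add: sum_negf)
    ultimately have y: "(\<Sum>j<m. (if i = p then if j = p then 0 else Q m j
                 else if j = p then - Q m i else Q j i) * y j) = 0" if "i < m" for i
      using that by (simp add: QB cong: if_cong)
    \<comment> \<open>The vanishing determinant is the transposed Gram determinant of tau(u, ., .)
      on the basis vectors other than \<open>p\<close>, with minus the vector \<open>m\<close> in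
      position \<open>p\<close>. Hence the entry \<open>y p\<close> reappears in \<open>v\<close>,
      negated, at index \<open>m\<close>.\<close>
    define v where "v = (\<lambda>j. if j = p then 0 else if j = m then - y p else y j)"
    have S_v: "S v k = (\<Sum>j\<in>{..<m} - {p}. y j * Q j k) - y p * Q m k" for k
    proof -
      have "(\<Sum>j<m. v j * Q j k) = (\<Sum>j\<in>{..<m} - {p}. y j * Q j k)"
        using pm by (simp add: sum.remove[of _ p] v_def)
      then show ?thesis
        using pm by (simp add: S_Q m v_def)
    qed
    show thesis
    proof (rule finish[of p v "if q = p then m else q"])
      fix k assume k: "k < n" "k \<noteq> p"
      show "S v k = 0"
      proof (cases "k = m")
        case True
        \<comment> \<open>Testing against the vector \<open>m\<close> corresponds to row
          \<open>p\<close> of the system.\<close>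
        have "(\<Sum>j\<in>{..<m} - {p}. Q m j * y j) = 0"
          using y[OF pm] pm by (simp add: sum.remove[of _ p])
        moreover have "Q m m = 0"
          by (simp add: Q_def diag23)
        moreover have "(\<Sum>j\<in>{..<m} - {p}. y j * Q j m) = - (\<Sum>j\<in>{..<m} - {p}. Q m j * y j)"
          by (subst Q_skew) (simp add: sum_negf mult.commute)
        ultimately show ?thesis
          using True by (simp add: S_v)
      next
        case False
        then have "k < m" using k m by simp
        from y[OF this] pm k show ?thesis
          by (simp add: sum.remove[of _ p] S_v mult.commute)
      qed
    qed (use m p pm q in \<open>auto simp: v_def\<close>)
  qed
qed

section \<open>Alternating forms on vector spaces\<close>

lemma alternating_form_add:
  assumes "alternating_form scale e \<omega>" "length xs + length ys + 1 = e"
  shows "\<omega> (xs @ (u + v) # ys) = \<omega> (xs @ u # ys) + \<omega> (xs @ v # ys)"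
  using assms by (simp add: alternating_form_def)

lemma alternating_form_scale:
  assumes "alternating_form scale e \<omega>" "length xs + length ys + 1 = e"
  shows "\<omega> (xs @ scale a u # ys) = a * \<omega> (xs @ u # ys)"
  using assms by (simp add: alternating_form_def)

lemma alternating_form_not_distinct:
  assumes "alternating_form scale e \<omega>" "length vs = e" "\<not> distinct vs"
  shows "\<omega> vs = 0"
  using assms by (simp add: alternating_form_def)

text \<open>Expand the form with \<open>u + v\<close> in both slots; the terms with a repeated
  argument vanish.\<close>

lemma alternating_form_swap:
  assumes \<omega>: "alternating_form scale e \<omega>" and len: "length xs + length ys + 2 = e"
  shows "\<omega> (xs @ u # v # ys) = - \<omega> (xs @ v # u # ys)"
proof -
  have zero: "\<omega> (xs @ w # w # ys) = 0" for w
    using len by (intro alternating_form_not_distinct[OF \<omega>]) auto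
  have "0 = \<omega> (xs @ (u + v) # (u + v) # ys)"
    by (simp add: zero)
  also have "\<dots> = \<omega> ((xs @ [u]) @ (u + v) # ys) + \<omega> ((xs @ [v]) @ (u + v) # ys)"
    using alternating_form_add[OF \<omega>, of xs "(u + v) # ys" u v] len by simp
  also have "\<dots> = \<omega> (xs @ u # v # ys) + \<omega> (xs @ v # u # ys)"
    using alternating_form_add[OF \<omega>, of "xs @ [u]" ys u v]
      alternating_form_add[OF \<omega>, of "xs @ [v]" ys u v] len by (simp add: zero)
  finally show ?thesis
    by (simp add: eq_neg_iff_add_eq_0)
qed

text \<open>Every adjacent swap only changes the sign, so tracking vanishing alone avoids computing
  signs of permutations.\<close>

lemma alternating_form_move:
  assumes \<omega>: "alternating_form scale e \<omega>" and "length zs + length xs + length ys + 1 = e"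
  shows "\<omega> (zs @ x # xs @ ys) = 0 \<longleftrightarrow> \<omega> (zs @ xs @ x # ys) = 0"
  using assms(2)
proof (induction xs arbitrary: zs)
  case (Cons a xs)
  then have "\<omega> (zs @ x # (a # xs) @ ys) = - \<omega> ((zs @ [a]) @ x # xs @ ys)"
    using alternating_form_swap[OF \<omega>, of zs "xs @ ys" x a] by simp
  then show ?case
    using Cons.IH[of "zs @ [a]"] Cons.prems by simp
qed simp

lemma alternating_form_permute:
  assumes \<omega>: "alternating_form scale e \<omega>"
    and "mset xs = mset ys" "length zs + length xs + length ws = e"
  shows "\<omega> (zs @ xs @ ws) = 0 \<longleftrightarrow> \<omega> (zs @ ys @ ws) = 0"
  using assms(2,3)
proof (induction xs arbitrary: ys zs)
  case (Cons x xs)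
  then obtain ys1 ys2 where ys: "ys = ys1 @ x # ys2"
    by (metis list.set_intros(1) mset_eq_setD split_list)
  then have mset: "mset xs = mset (ys1 @ ys2)"
    using Cons.prems by simp
  then have len: "length xs = length ys1 + length ys2"
    by (metis length_append size_mset)
  have "\<omega> (zs @ (x # xs) @ ws) = 0 \<longleftrightarrow> \<omega> ((zs @ [x]) @ (ys1 @ ys2) @ ws) = 0"
    using Cons.IH[OF mset, of "zs @ [x]"] Cons.prems by simp
  also have "\<dots> \<longleftrightarrow> \<omega> (zs @ ys @ ws) = 0"
    using alternating_form_move[OF \<omega>, of zs ys1 "ys2 @ ws" x] Cons.prems len ys by simp
  finally show ?case .
qed simp

section \<open>Vanishing of forms on spans, and independence\<close>

context vector_space
begin

lemma alternating_form_zero: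
  assumes "alternating_form scale e \<omega>" "length xs + length ys + 1 = e"
  shows "\<omega> (xs @ 0 # ys) = 0"
  using alternating_form_scale[OF assms, of 0] by simp

lemma alternating_form_sum:
  assumes \<omega>: "alternating_form scale e \<omega>" "length xs + length ys + 1 = e"
  shows "\<omega> (xs @ (\<Sum>i\<in>I. scale (a i) (f i)) # ys) = (\<Sum>i\<in>I. a i * \<omega> (xs @ f i # ys))"
  by (induction I rule: infinite_finite_induct)
    (simp_all add: alternating_form_zero[OF \<omega>] alternating_form_add[OF \<omega>] alternating_form_scale[OF \<omega>])

text \<open>Arguments are reduced to generators one at a time: \<open>ys\<close> holds those already
  reduced, \<open>xs\<close> those still arbitrary in the span.\<close>

lemma alternating_form_span_zero:
  assumes \<omega>: "alternating_form scale e \<omega>"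
    and len: "length ys + length xs + length vs = e"
    and zero: "\<And>us. set us \<subseteq> S \<Longrightarrow> length us = length ys + length xs \<Longrightarrow> \<omega> (us @ vs) = 0"
    and "set ys \<subseteq> S" "set xs \<subseteq> span S"
  shows "\<omega> (ys @ xs @ vs) = 0"
  using len zero assms(4-)
proof (induction xs arbitrary: ys)
  case Nil
  then show ?case using Nil.prems(2)[of ys] by simp
next
  case (Cons x xs)
  have len: "length ys + length (xs @ vs) + 1 = e"
    using Cons.prems(1) by simp
  have "x \<in> span S"
    using Cons.prems by simp
  then have "\<omega> (ys @ x # xs @ vs) = 0"
  proof (rule span_induct)
    show "subspace {x. \<omega> (ys @ x # xs @ vs) = 0}"
      by (rule subspaceI)
        (simp_all add: alternating_form_zero[OF \<omega> len] alternating_form_add[OF \<omega> len]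
          alternating_form_scale[OF \<omega> len])
  next
    fix x assume "x \<in> S"
    then have "\<omega> ((ys @ [x]) @ xs @ vs) = 0"
      using Cons.prems by (intro Cons.IH) auto
    then show "\<omega> (ys @ x # xs @ vs) = 0" by simp
  qed
  then show ?case by simp
qed

text \<open>Among lists of basis vectors, those with a repetition give zero and the others are
  permutations of \<open>bs\<close>, so testing \<open>bs\<close> itself is enough.\<close>

lemma singular_subspace_span:
  assumes \<omega>: "alternating_form scale e \<omega>"
    and indep: "independent (set bs)" and dist: "distinct bs" and len: "length bs \<le> e"
    and zero: "\<And>vs. length vs = e - length bs \<Longrightarrow> \<omega> (bs @ vs) = 0"
  shows "singular_subspace scale e \<omega> (length bs) (span (set bs))"
  unfolding singular_subspace_def
proof (intro conjI allI impI)
  show "dim (span (set bs)) = length bs"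
    using dim_span_eq_card_independent[OF indep] distinct_card[OF dist] by simp
next
  fix us vs :: "'b list" assume *: "set us \<subseteq> span (set bs) \<and> length us = length bs \<and> length vs = e - length bs"
  have "\<omega> (xs @ vs) = 0" if xs: "set xs \<subseteq> set bs" "length xs = length bs" for xs
  proof (cases "distinct xs")
    case True
    then have "set xs = set bs"
      using xs dist by (metis card_subset_eq distinct_card finite_set)
    then have "mset xs = mset bs"
      using True dist set_eq_iff_mset_eq_distinct by blast
    then show ?thesis
      using alternating_form_permute[OF \<omega>, of xs bs "[]" vs] zero[of vs] xs * len by simp
  next
    case False
    then show ?thesis
      using * xs len by (intro alternating_form_not_distinct[OF \<omega>]) auto
  qed
  then show "\<omega> (us @ vs) = 0"
    using alternating_form_span_zero[OF \<omega>, of "[]" us vs "set bs"] * len by simp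
qed simp

text \<open>Otherwise \<open>c j\<close> could be solved for and would lie in the span of the
  remaining independent vectors.\<close>

lemma combination_not_in_span:
  assumes indep: "independent (A \<union> c ` I)" and disj: "A \<inter> c ` I = {}"
    and inj: "inj_on c I" and I: "finite I" "j \<in> I" "d j \<noteq> 0"
  shows "(\<Sum>i\<in>I. scale (d i) (c i)) \<notin> span A"
proof
  assume *: "(\<Sum>i\<in>I. scale (d i) (c i)) \<in> span A"
  let ?R = "A \<union> c ` I - {c j}"
  have "(\<Sum>i\<in>I - {j}. scale (d i) (c i)) \<in> span ?R"
    using inj I by (intro span_sum span_scale span_base) (auto simp: inj_on_def)
  moreover have "(\<Sum>i\<in>I. scale (d i) (c i)) \<in> span ?R"
    using * disj I span_mono[of A ?R] by auto
  ultimately have "scale (d j) (c j) \<in> span ?R"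
    using I by (simp add: sum.remove span_add_eq2)
  then have "c j \<in> span ?R"
    using span_scale[of "scale (d j) (c j)" ?R "inverse (d j)"] I by simp
  with indep I show False
    by (auto simp: dependent_def)
qed

end

section \<open>Reduction of \<open>e\<close>-forms to trilinear tensors\<close>

theorem mainTheorem1:
  fixes scale :: "'a::field \<Rightarrow> 'b::ab_group_add \<Rightarrow> 'b"
    and Basis :: "'b set"
    and e :: nat
    and \<omega> :: "'b list \<Rightarrow> 'a"
  assumes "quasi_alg_closed TYPE('a)"
    and "finite_dimensional_vector_space scale Basis"
    and "e \<ge> 3"
    and "vector_space.dim scale (UNIV :: 'b set) \<ge> e + 1"
    and "alternating_form scale e \<omega>"
  shows "\<exists>U. singular_subspace scale e \<omega> (e - 1) U"
proof -
  interpret finite_dimensional_vector_space scale Basis by fact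
  note \<omega> = \<open>alternating_form scale e \<omega>\<close>
  obtain bs where bs: "set bs = Basis" "distinct bs"
    using finite_distinct_list[OF finite_Basis] by blast
  have "length bs \<ge> e + 1"
    using assms(4) bs by (metis dim_UNIV distinct_card)
  \<comment> \<open>The \<open>e - 3\<close> vectors of \<open>as\<close> are held fixed, leaving at
    least four in \<open>cs\<close> because \<open>bs\<close> has at least
    \<open>e + 1\<close>.\<close>
  define as cs where "as = take (e - 3) bs" and "cs = drop (e - 3) bs"
  define n c where "n = length cs" and "c = (!) cs"
  have bs_split: "bs = as @ cs"
    by (simp add: as_def cs_def)
  have len_as: "length as = e - 3" and n: "n \<ge> 4"
    using \<open>length bs \<ge> e + 1\<close> assms(3) by (auto simp: as_def cs_def n_def)
  have set_cs: "set cs = c ` {..<n}"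
    by (auto simp: c_def n_def set_conv_nth)
  have dist: "distinct as" "set as \<inter> c ` {..<n} = {}"
    using bs(2) by (auto simp: bs_split simp flip: set_cs)
  have inj: "inj_on c {..<n}"
    using bs(2) by (auto simp: bs_split c_def n_def inj_on_nth)
  have Basis_split: "Basis = set as \<union> c ` {..<n}"
    using bs(1) by (simp add: bs_split set_cs)
  define T where "T = (\<lambda>i j k. \<omega> (as @ [c i, c j, c k]))"
  have skew: "T i j k = - T j i k" "T i j k = - T i k j" for i j k
    using alternating_form_swap[OF \<omega>, of as "[c k]" "c i" "c j"]
      alternating_form_swap[OF \<omega>, of "as @ [c i]" "[]" "c j" "c k"] len_as assms(3)
    by (simp_all add: T_def)
  have diag: "T i i k = 0" "T i k k = 0" for i k
    unfolding T_def using len_as assms(3) by (auto intro!: alternating_form_not_distinct[OF \<omega>])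
  obtain u v p q where p: "p < n" "u p \<noteq> 0" "v p = 0" and q: "q < n" "v q \<noteq> 0"
    and uv: "\<And>k. k < n \<Longrightarrow> (\<Sum>i<n. \<Sum>j<n. u i * v j * T i j k) = 0"
    by (rule alternating_tensor_singular_pair[where T = T, OF assms(1) n skew(1) diag(1) skew(2) diag(2)])
      blast
  define x where "x = (\<Sum>i<n. scale (u i) (c i))"
  define y where "y = (\<Sum>i<n. scale (v i) (c i))"
  have not_in_span: "(\<Sum>i<n. scale (d i) (c i)) \<notin> span (set as)" if "j < n" "d j \<noteq> 0" for d j
    using that independent_Basis dist inj by (intro combination_not_in_span) (auto simp: Basis_split)
  have x: "x \<notin> span (set as)"
    unfolding x_def using p by (intro not_in_span)
  have y: "y \<notin> span (insert x (set as))"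
  proof
    assume "y \<in> span (insert x (set as))"
    then obtain k where "y - scale k x \<in> span (set as)"
      by (auto simp: span_breakdown_eq)
    moreover have "y - scale k x = (\<Sum>i<n. scale (v i - k * u i) (c i))"
      by (simp add: x_def y_def scale_sum_right scale_left_diff_distrib sum_subtractf)
    ultimately have "v i - k * u i = 0" if "i < n" for i
      using not_in_span[of i "\<lambda>i. v i - k * u i"] that by auto
    \<comment> \<open>Coordinate \<open>p\<close> forces \<open>k = 0\<close>, and then coordinate
      \<open>q\<close> contradicts \<open>v q \<noteq> 0\<close>.\<close>
    from this[of p] this[of q] show False
      using p q by auto
  qed
  \<comment> \<open>By linearity \<open>w\<close> may be a basis vector: one from \<open>as\<close>
    repeats an argument, one from \<open>cs\<close> is covered by \<open>uv\<close>.\<close>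
  have zero: "\<omega> (as @ [x, y, w]) = 0" for w
  proof -
    have "w \<in> span Basis"
      by (simp add: span_Basis)
    then show ?thesis
    proof (rule span_induct)
      have len: "length (as @ [x, y]) + length [] + 1 = e"
        using len_as assms(3) by simp
      show "subspace {w. \<omega> (as @ [x, y, w]) = 0}"
        using alternating_form_zero[OF \<omega> len] alternating_form_add[OF \<omega> len]
          alternating_form_scale[OF \<omega> len]
        by (intro subspaceI) simp_all
    next
      fix w assume "w \<in> Basis"
      then consider "w \<in> set as" | k where "k < n" "w = c k"
        by (auto simp: Basis_split)
      then show "\<omega> (as @ [x, y, w]) = 0"
      proof cases
        case 1
        then show ?thesis
          using len_as assms(3) by (intro alternating_form_not_distinct[OF \<omega>]) auto
      next
        case (2 k)
        have "\<omega> (as @ [x, y, c k]) = (\<Sum>i<n. u i * \<omega> (as @ [c i, y, c k]))"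
          using alternating_form_sum[OF \<omega>, of as "[y, c k]" u c "{..<n}"] len_as assms(3)
          by (simp add: x_def)
        also have "\<dots> = (\<Sum>i<n. u i * (\<Sum>j<n. v j * T i j k))"
          using alternating_form_sum[OF \<omega>, of "as @ [c i]" "[c k]" v c "{..<n}" for i] len_as assms(3)
          by (simp add: y_def T_def)
        also have "\<dots> = 0"
          using uv[OF 2(1)] by (simp add: sum_distrib_left mult.assoc)
        finally show ?thesis
          using 2(2) by simp
      qed
    qed
  qed
  let ?bs = "as @ [x, y]"
  have len: "length ?bs = e - 1"
    using len_as assms(3) by simp
  have "independent (set as)"
    using independent_Basis by (rule independent_mono) (auto simp: Basis_split)
  then have "independent (insert y (insert x (set as)))"
    using x y by (simp add: independent_insert)
  then have "independent (set ?bs)"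
    by (simp add: insert_commute Un_commute)
  moreover have "distinct ?bs"
    using dist(1) x y span_base by auto
  \<comment> \<open>Here \<open>vs\<close> consists of a single vector, as \<open>?bs\<close> has
    length \<open>e - 1\<close>.\<close>
  moreover have "\<omega> (?bs @ vs) = 0" if "length vs = e - length ?bs" for vs
    using that len assms(3) zero by (cases vs) auto
  ultimately have "singular_subspace scale e \<omega> (length ?bs) (span (set ?bs))"
    using len by (intro singular_subspace_span[OF \<omega>]) auto
  then show ?thesis
    using len by metis
qed

end
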